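(* Let $N$ be a positive integer, let $X$ and $Y$ be two independent real random variables such that $Y$ has finite moments up to order $N$, and let $f$ be an $N$ times differentiable function such that $f^{(k)}(X)$ and $f^{(k)}(X+Y)$ are integrable for every $k=0,\dots,N$. Then $$\mathbb{E}[f(X)]=\sum_{d\ge 0}(-1)^d\sum_{\mathbf{J}\in\mathbb{N}_*^d,\ |\mathbf{J}|\le N} m_Y^{(\mathbf{J})}\,\mathbb{E}\big[f^{(|\mathbf{J}|)}(X+Y)\big]+\varepsilon_N(f,X,Y),$$ where $$\varepsilon_N(f,X,Y)=-\sum_{d\ge 0}(-1)^d\sum_{\mathbf{J}\in\mathbb{N}_*^d,\ |\mathbf{J}|\le N} m_Y^{(\mathbf{J})}\,\delta_{N-|\mathbf{J}|}\big(f^{(|\mathbf{J}|)},X,Y\big).$$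
   Context: $\mathbb{N}_*=\{1,2,3,\dots\}$. For $k\in\mathbb{N}$, $m_Y^{(k)}:=\mathbb{E}[Y^k]/k!$. For $d\ge1$ and $\mathbf{J}=(j_1,\dots,j_d)\in\mathbb{N}_*^d$, $|\mathbf{J}|:=j_1+\cdots+j_d$ and $m_Y^{(\mathbf{J})}:=m_Y^{(j_1)}\cdots m_Y^{(j_d)}$. By convention $\mathbb{N}_*^0=\{\emptyset\}$, $|\emptyset|=0$, $m_Y^{(\emptyset)}=1$. (The sums over $d$ are finite because $|\mathbf{J}|\ge d$.) For an integer $M\ge0$, $\delta_M$ denotes the error term of the $M$-th order Taylor expansion: $$\delta_M(f,X,Y):=\mathbb{E}[f(X+Y)]-\sum_{k=0}^M m_Y^{(k)}\,\mathbb{E}[f^{(k)}(X)].$$ *)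

theory Defs
  imports "HOL-Probability.Probability"
begin

definition scaled_moment :: "'a measure \<Rightarrow> ('a \<Rightarrow> real) \<Rightarrow> nat \<Rightarrow> real" where
  "scaled_moment M Y k = prob_space.expectation M (\<lambda>\<omega>. Y \<omega> ^ k) / fact k"

(* A multi-index (j_1, ..., j_d) of positive integers is encoded as a list of length d,
   and |J| is sum_list J. The empty list is the unique multi-index for d = 0. *)

definition multi_indices :: "nat \<Rightarrow> nat \<Rightarrow> nat list set" where
  "multi_indices d N = {J. length J = d \<and> (\<forall>j\<in>set J. 1 \<le> j) \<and> sum_list J \<le> N}"

definition multi_moment :: "'a measure \<Rightarrow> ('a \<Rightarrow> real) \<Rightarrow> nat list \<Rightarrow> real" where
  "multi_moment M Y J = prod_list (map (scaled_moment M Y) J)"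

definition times_differentiable :: "nat \<Rightarrow> (real \<Rightarrow> real) \<Rightarrow> bool" where
  "times_differentiable N f \<longleftrightarrow> (\<forall>k<N. \<forall>x. (deriv ^^ k) f differentiable (at x))"

definition taylor_error ::
  "'a measure \<Rightarrow> nat \<Rightarrow> (real \<Rightarrow> real) \<Rightarrow> ('a \<Rightarrow> real) \<Rightarrow> ('a \<Rightarrow> real) \<Rightarrow> real" where
  "taylor_error M n f X Y =
     prob_space.expectation M (\<lambda>\<omega>. f (X \<omega> + Y \<omega>))
     - (\<Sum>k\<le>n. scaled_moment M Y k * prob_space.expectation M (\<lambda>\<omega>. (deriv ^^ k) f (X \<omega>)))"

(* In the series over d only the terms with d <= N can be nonzero, because
   multi_indices d N is empty for d > N. *)

definition inversion_error ::
  "'a measure \<Rightarrow> nat \<Rightarrow> (real \<Rightarrow> real) \<Rightarrow> ('a \<Rightarrow> real) \<Rightarrow> ('a \<Rightarrow> real) \<Rightarrow> real" where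
  "inversion_error M N f X Y =
     - (\<Sum>d. (- 1) ^ d * (\<Sum>J\<in>multi_indices d N.
          multi_moment M Y J
          * taylor_error M (N - sum_list J) ((deriv ^^ sum_list J) f) X Y))"

end

theory Submission imports Defs begin

text \<open>Write \<open>a\<^sub>k\<close> for the expectation of the \<open>k\<close>-th derivative at \<open>X\<close> and
  \<open>T\<^sub>d\<close> for the sum over multi-indices \<open>J\<close> of length \<open>d\<close> of the \<open>J\<close>-th moment times \<open>a\<^bsub>|J|\<^esub>\<close>.
  Subtracting the Taylor errors cancels the expectations at \<open>X + Y\<close> and leaves the double sum of
  moments times Taylor polynomials. Its terms of order \<open>0\<close> give \<open>T\<^sub>d\<close>; a term of order \<open>k \<ge> 1\<close>
  prepends \<open>k\<close> to \<open>J\<close>, so these together give \<open>T\<^bsub>d+1\<^esub>\<close>.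
  The alternating sum of \<open>T\<^sub>d + T\<^bsub>d+1\<^esub>\<close> telescopes to \<open>T\<^sub>0 = a\<^sub>0\<close>.\<close>

lemma finite_multi_indices: "finite (multi_indices d N)"
proof (rule finite_subset)
  show "multi_indices d N \<subseteq> {J. set J \<subseteq> {..N} \<and> length J = d}"
    by (auto simp: multi_indices_def dest!: member_le_sum_list)
  show "finite {J. set J \<subseteq> {..N} \<and> length J = d}"
    by (rule finite_lists_length_eq) simp
qed

lemma multi_indices_0: "multi_indices 0 N = {[]}"
  by (auto simp: multi_indices_def)

lemma multi_indices_eq_empty:
  assumes "N < d"
  shows "multi_indices d N = {}"
proof -
  have "length J \<le> sum_list J" if "\<forall>j\<in>set J. 1 \<le> j" for J :: "nat list"
    using that by (induction J) auto
  with assms show ?thesis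
    by (fastforce simp: multi_indices_def)
qed

text \<open>The head \<open>k\<close> may use whatever the tail leaves of the bound
  \<open>N\<close>. The subtraction does not truncate, since \<open>sum_list J\<close> is at most
  \<open>N\<close>, and the range of \<open>k\<close> is that of the Taylor terms of positive
  order.\<close>

lemma multi_indices_Suc:
  "multi_indices (Suc d) N =
    (\<lambda>(J, k). k # J) ` (SIGMA J:multi_indices d N. {1..N - sum_list J})"
proof (intro equalityI subsetI)
  fix K assume K: "K \<in> multi_indices (Suc d) N"
  then obtain k J where "K = k # J"
    by (cases K) (auto simp: multi_indices_def)
  with K have "(J, k) \<in> (SIGMA J:multi_indices d N. {1..N - sum_list J})"
    by (auto simp: multi_indices_def)
  with \<open>K = k # J\<close> show "K \<in> (\<lambda>(J, k). k # J) ` (SIGMA J:multi_indices d N. {1..N - sum_list J})"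
    by force
qed (auto simp: multi_indices_def)

lemma sum_multi_indices_Suc:
  fixes g :: "nat list \<Rightarrow> 'b::comm_monoid_add"
  shows "(\<Sum>K\<in>multi_indices (Suc d) N. g K) =
    (\<Sum>J\<in>multi_indices d N. \<Sum>k=1..N - sum_list J. g (k # J))"
proof -
  have "inj_on (\<lambda>(J, k). k # J) (SIGMA J:multi_indices d N. {1..N - sum_list J})"
    by (auto simp: inj_on_def)
  then show ?thesis
    by (simp add: multi_indices_Suc sum.reindex sum.Sigma finite_multi_indices case_prod_unfold)
qed

lemma suminf_multi_indices:
  fixes c :: "nat \<Rightarrow> 'b::real_normed_algebra"
  shows "(\<Sum>d. c d * (\<Sum>J\<in>multi_indices d N. g J)) =
    (\<Sum>d\<le>N. c d * (\<Sum>J\<in>multi_indices d N. g J))"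
  by (rule suminf_finite) (auto simp: multi_indices_eq_empty)

lemma sum_alternating_telescope:
  fixes T :: "nat \<Rightarrow> 'b::comm_ring_1"
  shows "(\<Sum>d\<le>n. (- 1) ^ d * (T d + T (Suc d))) = T 0 + (- 1) ^ n * T (Suc n)"
  by (induction n) (auto simp: algebra_simps)

text \<open>The algebraic core, free of probability: \<open>m\<close> stands for the scaled moments
  and \<open>a\<close> for the expectations of the derivatives at \<open>X\<close>.\<close>

lemma alternating_multi_index_inversion:
  fixes m a :: "nat \<Rightarrow> 'b::comm_ring_1"
  assumes "m 0 = 1"
  shows "(\<Sum>d\<le>N. (- 1) ^ d * (\<Sum>J\<in>multi_indices d N.
      prod_list (map m J) * (\<Sum>k\<le>N - sum_list J. m k * a (k + sum_list J)))) = a 0"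
proof -
  define T where "T d = (\<Sum>J\<in>multi_indices d N. prod_list (map m J) * a (sum_list J))" for d
  have "(\<Sum>J\<in>multi_indices d N.
      prod_list (map m J) * (\<Sum>k\<le>N - sum_list J. m k * a (k + sum_list J))) = T d + T (Suc d)" for d
  proof -
    \<comment> \<open>The term \<open>k = 0\<close> splits off because \<open>m 0 = 1\<close>; in
      the others the factor \<open>m k\<close> joins the product as the new head of
      \<open>J\<close>.\<close>
    have "prod_list (map m J) * (\<Sum>k\<le>n. m k * a (k + sum_list J)) =
        prod_list (map m J) * a (sum_list J)
        + (\<Sum>k=1..n. prod_list (map m (k # J)) * a (sum_list (k # J)))" for J n
      using assms
      by (simp add: atMost_atLeast0 sum.atLeast_Suc_atMost distrib_left sum_distrib_left ac_simps)
    then show ?thesis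
      by (simp only: T_def sum_multi_indices_Suc sum.distrib)
  qed
  then have "(\<Sum>d\<le>N. (- 1) ^ d * (\<Sum>J\<in>multi_indices d N.
      prod_list (map m J) * (\<Sum>k\<le>N - sum_list J. m k * a (k + sum_list J)))) =
      T 0 + (- 1) ^ N * T (Suc N)"
    by (simp only: sum_alternating_telescope)
  \<comment> \<open>The boundary term \<open>T (Suc N)\<close> is an empty sum: \<open>N + 1\<close>
    positive entries add up to more than \<open>N\<close>.\<close>
  then show ?thesis
    by (simp add: T_def multi_indices_0 multi_indices_eq_empty)
qed

theorem proposition1p1:
  fixes M :: "'a measure" and X Y :: "'a \<Rightarrow> real" and f :: "real \<Rightarrow> real" and N :: nat
  assumes "prob_space M"
    and "N \<ge> 1"
    and "X \<in> borel_measurable M" and "Y \<in> borel_measurable M"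
    and "prob_space.indep_var M borel X borel Y"
    and "\<And>k. k \<le> N \<Longrightarrow> integrable M (\<lambda>\<omega>. Y \<omega> ^ k)"
    and "times_differentiable N f"
    and "\<And>k. k \<le> N \<Longrightarrow> integrable M (\<lambda>\<omega>. (deriv ^^ k) f (X \<omega>))"
    and "\<And>k. k \<le> N \<Longrightarrow> integrable M (\<lambda>\<omega>. (deriv ^^ k) f (X \<omega> + Y \<omega>))"
  shows "prob_space.expectation M (\<lambda>\<omega>. f (X \<omega>)) =
    (\<Sum>d. (- 1) ^ d * (\<Sum>J\<in>multi_indices d N.
        multi_moment M Y J
        * prob_space.expectation M (\<lambda>\<omega>. (deriv ^^ sum_list J) f (X \<omega> + Y \<omega>))))
    + inversion_error M N f X Y"
proof -
  interpret prob_space M by fact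
  let ?m = "scaled_moment M Y"
  let ?a = "\<lambda>k. expectation (\<lambda>\<omega>. (deriv ^^ k) f (X \<omega>))"
  let ?b = "\<lambda>k. expectation (\<lambda>\<omega>. (deriv ^^ k) f (X \<omega> + Y \<omega>))"
  have "?m 0 = 1"
    by (simp add: scaled_moment_def prob_space)
  \<comment> \<open>Iterated derivatives compose, so the Taylor terms of the derivative of order
    \<open>sum_list J\<close> are entries of the single sequence \<open>?a\<close>.\<close>
  have error: "taylor_error M (N - sum_list J) ((deriv ^^ sum_list J) f) X Y =
      ?b (sum_list J) - (\<Sum>k\<le>N - sum_list J. ?m k * ?a (k + sum_list J))" for J
    by (simp add: taylor_error_def funpow_add)
  have "(\<Sum>d. (- 1) ^ d * (\<Sum>J\<in>multi_indices d N. multi_moment M Y J * ?b (sum_list J)))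
      + inversion_error M N f X Y =
      (\<Sum>d\<le>N. (- 1) ^ d * (\<Sum>J\<in>multi_indices d N.
        prod_list (map ?m J) * (\<Sum>k\<le>N - sum_list J. ?m k * ?a (k + sum_list J))))"
    unfolding inversion_error_def suminf_multi_indices error
    by (simp add: multi_moment_def right_diff_distrib sum_subtractf)
  also have "\<dots> = ?a 0"
    using \<open>?m 0 = 1\<close> by (rule alternating_multi_index_inversion[where m = ?m and a = ?a])
  finally show ?thesis
    by simp
qed

end
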